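(* Let $1<p,q<\infty$ and define $\frac1r:=\frac1q-\frac1p$ and $\frac\alpha d:=\frac1p-\frac1q$. Let $\mu,\lambda,\nu$ be weights on $\mathbb{R}^d$ and $\mu':=\mu^{-p'/p}$. Suppose there is a constant $C>0$ such that for all $b\in L^1_{\mathrm{loc}}(\mathbb{R}^d)$ for which $\Pi_b$ is well defined we have $$\|\Pi_b\|_{L^p(\mu)\to L^q(\lambda)}\le C\cdot\begin{cases}\|b\|_{\mathrm{BMO}^\alpha_\nu}&\text{if }p\le q,\\ \|M^{\#}_\nu b\|_{L^r(\nu)}&\text{if }p>q.\end{cases}$$ Then $(\mu',\lambda,\nu)\in B_{p',q}$, i.e. $$\sup_{Q}\,\langle\mu'\rangle_Q^{1/p'}\langle\lambda\rangle_Q^{1/q}\langle\nu\rangle_Q^{1/p+1/q'}<\infty.$$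
   Context: A dyadic lattice $\mathcal D=\bigcup_{k\in\mathbb Z}\mathcal D_k$ on $\mathbb{R}^d$ is fixed: $\mathcal D_k$ is a partition of $\mathbb{R}^d$ into (axis-parallel) cubes of side length $2^{-k}$ and $\mathcal D_{k+1}$ refines $\mathcal D_k$. For $Q\in\mathcal D$, $\widehat Q$ is the smallest $R\in\mathcal D$ with $Q\subsetneq R$. All suprema over cubes are over $Q\in\mathcal D$. $\langle f\rangle_Q:=\frac1{|Q|}\int_Qf\,dx$; $p'$ is the conjugate exponent. A weight is a locally integrable $w:\mathbb{R}^d\to(0,\infty)$; $w(E):=\int_Ew\,dx$; $\|f\|_{L^p(w)}:=(\int|f|^pw\,dx)^{1/p}$. $\|b\|_{\mathrm{BMO}^\alpha_\nu}:=\sup_Q\frac1{\nu(Q)^{1+\alpha/d}}\int_Q|b-\langle b\rangle_Q|\,dx$ and $M^{\#}_\nu b:=\sup_Q\frac{\mathbf 1_Q}{\nu(Q)}\int_Q|b-\langle b\rangle_Q|\,dx$. Paraproduct: $D_Qb:=\sum_{R\in\mathcal D:\widehat R=Q}\langle b\rangle_R\mathbf 1_R-\langle b\rangle_Q\mathbf 1_Q$ and $\Pi_bf:=\sum_{Q\in\mathcal D}D_Qb\,\langle f\rangle_Q$ for $f\in L^\infty_c$ (bounded, compactly supported). $\Pi_b$ is well defined if for each $f\in L^\infty_c$ this sum converges unconditionally in $L^1(K)$ for every compact $K$. $\|\Pi_b\|_{L^p(\mu)\to L^q(\lambda)}\in[0,\infty]$ is the least $N$ with $\|\Pi_bf\|_{L^q(\lambda)}\le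 N\|f\|_{L^p(\mu)}$ for all $f\in L^\infty_c$. *)

theory Defs
  imports "HOL-Analysis.Analysis" "HOL-Library.Disjoint_Sets"
begin

(* For subsets of real^'n, is_interval means: product of one-dimensional intervals. The predicate
   leaves open which faces belong to the cube, so half-open cubes of either kind are included. *)
definition cube_of_side :: "real \<Rightarrow> (real^'n) set \<Rightarrow> bool" where
  "cube_of_side l Q \<longleftrightarrow> is_interval Q \<and> (\<exists>a. box a (a + vec l) \<subseteq> Q \<and> Q \<subseteq> cbox a (a + vec l))"

(* refines UNIV P P' contains that both P and P' are (genuine, disjoint) partitions of UNIV. *)
definition dyadic_lattice :: "(int \<Rightarrow> (real^'n) set set) \<Rightarrow> bool" where
  "dyadic_lattice D \<longleftrightarrow>
     (\<forall>k. \<forall>Q\<in>D k. cube_of_side (2 powi (- k)) Q) \<and> (\<forall>k. refines UNIV (D (k + 1)) (D k))"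

definition cubes :: "(int \<Rightarrow> (real^'n) set set) \<Rightarrow> (real^'n) set set" where
  "cubes D = (\<Union>k. D k)"

definition parent :: "(int \<Rightarrow> (real^'n) set set) \<Rightarrow> (real^'n) set \<Rightarrow> (real^'n) set" where
  "parent D Q = (LEAST R. R \<in> cubes D \<and> Q \<subset> R)"

definition locally_integrable :: "(real^'n \<Rightarrow> real) \<Rightarrow> bool" where
  "locally_integrable f \<longleftrightarrow> (\<forall>K. compact K \<longrightarrow> set_integrable lebesgue K f)"

definition weight :: "(real^'n \<Rightarrow> real) \<Rightarrow> bool" where
  "weight w \<longleftrightarrow> locally_integrable w \<and> (\<forall>x. 0 < w x)"

definition Linfty_c :: "(real^'n \<Rightarrow> real) set" where
  "Linfty_c = {f. f \<in> borel_measurable lebesgue \<and> bounded (range f) \<and>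
                  (\<exists>K. compact K \<and> (\<forall>x. x \<notin> K \<longrightarrow> f x = 0))}"

definition avg :: "(real^'n) set \<Rightarrow> (real^'n \<Rightarrow> real) \<Rightarrow> real" where
  "avg Q f = set_lebesgue_integral lebesgue Q f / measure lebesgue Q"

(* Integrals and averages of nonnegative functions are extended-valued, so that they are meaningful
   without integrability (in particular for the dual weight, which need not be locally integrable). *)
definition mass :: "(real^'n \<Rightarrow> real) \<Rightarrow> (real^'n) set \<Rightarrow> ennreal" where
  "mass w E = (\<integral>\<^sup>+x\<in>E. ennreal (w x) \<partial>lebesgue)"

definition eavg :: "(real^'n) set \<Rightarrow> (real^'n \<Rightarrow> real) \<Rightarrow> ennreal" where
  "eavg Q w = mass w Q / emeasure lebesgue Q"

(* Only meant for exponents a > 0. *)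
definition epowr :: "ennreal \<Rightarrow> real \<Rightarrow> ennreal" where
  "epowr x a = (if x = \<infinity> then \<infinity> else ennreal (enn2real x powr a))"

definition eLp_norm :: "real \<Rightarrow> (real^'n \<Rightarrow> real) \<Rightarrow> (real^'n \<Rightarrow> ennreal) \<Rightarrow> ennreal" where
  "eLp_norm p w g = epowr (\<integral>\<^sup>+x. epowr (g x) p * ennreal (w x) \<partial>lebesgue) (1 / p)"

definition Lp_norm :: "real \<Rightarrow> (real^'n \<Rightarrow> real) \<Rightarrow> (real^'n \<Rightarrow> real) \<Rightarrow> ennreal" where
  "Lp_norm p w f = eLp_norm p w (\<lambda>x. ennreal \<bar>f x\<bar>)"

definition oscillation :: "(real^'n) set \<Rightarrow> (real^'n \<Rightarrow> real) \<Rightarrow> ennreal" where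
  "oscillation Q b = (\<integral>\<^sup>+x\<in>Q. ennreal \<bar>b x - avg Q b\<bar> \<partial>lebesgue)"

definition BMO_norm ::
  "(int \<Rightarrow> (real^'n) set set) \<Rightarrow> real \<Rightarrow> (real^'n \<Rightarrow> real) \<Rightarrow> (real^'n \<Rightarrow> real) \<Rightarrow> ennreal" where
  "BMO_norm D \<alpha> \<nu> b =
     (SUP Q\<in>cubes D. oscillation Q b / epowr (mass \<nu> Q) (1 + \<alpha> / real CARD('n)))"

definition sharp_maximal ::
  "(int \<Rightarrow> (real^'n) set set) \<Rightarrow> (real^'n \<Rightarrow> real) \<Rightarrow> (real^'n \<Rightarrow> real) \<Rightarrow> real^'n \<Rightarrow> ennreal" where
  "sharp_maximal D \<nu> b x = (SUP Q\<in>cubes D. indicator Q x / mass \<nu> Q * oscillation Q b)"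

definition mart_diff ::
  "(int \<Rightarrow> (real^'n) set set) \<Rightarrow> (real^'n) set \<Rightarrow> (real^'n \<Rightarrow> real) \<Rightarrow> real^'n \<Rightarrow> real" where
  "mart_diff D Q b x =
     (\<Sum>R\<in>{R \<in> cubes D. parent D R = Q}. avg R b * indicator R x) - avg Q b * indicator Q x"

(* Unconditional convergence of the sum of h Q over Q in I, with sum g, in L^1(K): convergence of
   the net of finite partial sums. *)
definition has_unconditional_sum_L1 ::
  "'i set \<Rightarrow> ('i \<Rightarrow> real^'n \<Rightarrow> real) \<Rightarrow> (real^'n) set \<Rightarrow> (real^'n \<Rightarrow> real) \<Rightarrow> bool" where
  "has_unconditional_sum_L1 I h K g \<longleftrightarrow>
     (\<forall>i\<in>I. set_integrable lebesgue K (h i)) \<and> set_integrable lebesgue K g \<and>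
     ((\<lambda>F. \<integral>\<^sup>+x\<in>K. ennreal \<bar>(\<Sum>i\<in>F. h i x) - g x\<bar> \<partial>lebesgue) \<longlongrightarrow> 0) (finite_subsets_at_top I)"

definition paraproduct_term ::
  "(int \<Rightarrow> (real^'n) set set) \<Rightarrow> (real^'n \<Rightarrow> real) \<Rightarrow> (real^'n \<Rightarrow> real) \<Rightarrow> (real^'n) set
     \<Rightarrow> real^'n \<Rightarrow> real" where
  "paraproduct_term D b f Q x = mart_diff D Q b x * avg Q f"

definition paraproduct_well_defined ::
  "(int \<Rightarrow> (real^'n) set set) \<Rightarrow> (real^'n \<Rightarrow> real) \<Rightarrow> bool" where
  "paraproduct_well_defined D b \<longleftrightarrow>
     (\<forall>f\<in>Linfty_c. \<forall>K. compact K \<longrightarrow>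
        (\<exists>g. has_unconditional_sum_L1 (cubes D) (paraproduct_term D b f) K g))"

(* The L^1(K)-limits for different K agree almost everywhere on overlaps; the paraproduct is any
   function on the whole space that represents all of them (it is unique almost everywhere). *)
definition paraproduct ::
  "(int \<Rightarrow> (real^'n) set set) \<Rightarrow> (real^'n \<Rightarrow> real) \<Rightarrow> (real^'n \<Rightarrow> real) \<Rightarrow> real^'n \<Rightarrow> real" where
  "paraproduct D b f =
     (SOME g. \<forall>K. compact K \<longrightarrow>
        has_unconditional_sum_L1 (cubes D) (paraproduct_term D b f) K g)"

definition op_norm ::
  "((real^'n \<Rightarrow> real) \<Rightarrow> real^'n \<Rightarrow> real)
     \<Rightarrow> real \<Rightarrow> (real^'n \<Rightarrow> real) \<Rightarrow> real \<Rightarrow> (real^'n \<Rightarrow> real) \<Rightarrow> ennreal" where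
  "op_norm T p \<mu> q lam = Inf {N. \<forall>f\<in>Linfty_c. Lp_norm q lam (T f) \<le> N * Lp_norm p \<mu> f}"

end

theory Submission
  imports Defs
begin

text \<open>Fix a cube \<open>Q\<close> and let \<open>b\<close> be \<open>1\<close> on one half of the dyadic children of \<open>Q\<close>, \<open>-1\<close> on the
  other half, and \<open>0\<close> off \<open>Q\<close>. Then \<open>D_P b\<close> vanishes unless \<open>P = Q\<close>, so that \<open>\<Pi>_b f = b <f>_Q\<close>, and
  the oscillation of \<open>b\<close> over \<open>P\<close> is \<open>|Q|\<close> if \<open>P\<close> contains \<open>Q\<close> and \<open>0\<close> otherwise. Hence both norms of
  \<open>b\<close> are at most a constant times \<open>|Q| \<nu>(Q) powr (-1/p - 1/q')\<close>: for the BMO norm this is immediate, and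
  for the sharp maximal function one sums over the ancestors of \<open>Q\<close>, comparing with the integral of
  \<open>t powr (-r)\<close> over \<open>t \<ge> \<nu>(Q)\<close>. Since \<open>|b| = 1\<close> on \<open>Q\<close>, testing the operator bound on truncations of
  \<open>\<mu>'\<close> restricted to \<open>Q\<close> gives the claim.\<close>

section \<open>Dyadic lattices\<close>

text \<open>The cube differs from the closed box only by boundary faces, a negligible set, so
  measurability and volume do not depend on which faces belong to it.\<close>

lemma cube_of_side_measure:
  fixes Q :: "(real^'n) set"
  assumes "cube_of_side l Q" "0 < l"
  shows "Q \<in> lmeasurable" "measure lebesgue Q = l ^ CARD('n)" "bounded Q"
proof -
  obtain a where a: "box a (a + vec l) \<subseteq> Q" "Q \<subseteq> cbox a (a + vec l)"
    using assms unfolding cube_of_side_def by blast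
  have ne: "cbox a (a + vec l) \<noteq> {}"
    using assms(2) by (auto simp: interval_ne_empty_cart)
  have neg: "negligible (cbox a (a + vec l) - Q \<union> (Q - cbox a (a + vec l)))"
    by (rule negligible_subset[OF negligible_frontier_interval[of a "a + vec l"]]) (use a in auto)
  show "Q \<in> lmeasurable"
    by (rule lmeasurable_negligible_symdiff[OF lmeasurable_cbox neg])
  show "measure lebesgue Q = l ^ CARD('n)"
    using measure_negligible_symdiff[OF lmeasurable_cbox neg] ne
    by (simp add: content_cbox_cart)
  show "bounded Q"
    using a(2) bounded_cbox bounded_subset by blast
qed

text \<open>The index set of the sum in \<open>mart_diff\<close>, so that finiteness and
  disjointness of the children apply to that sum directly.\<close>

definition children :: "(int \<Rightarrow> (real^'n) set set) \<Rightarrow> (real^'n) set \<Rightarrow> (real^'n) set set" where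
  "children D Q = {R \<in> cubes D. parent D R = Q}"

context
  fixes D :: "int \<Rightarrow> (real^'n) set set"
  assumes D: "dyadic_lattice D"
begin

lemma dyadic_measure:
  assumes "Q \<in> D k"
  shows "Q \<in> lmeasurable" "measure lebesgue Q = (2 powi (- k)) ^ CARD('n)" "bounded Q"
    "0 < measure lebesgue Q"
proof -
  have c: "cube_of_side (2 powi (- k)) Q" and l: "(0::real) < 2 powi (- k)"
    using D assms by (auto simp: dyadic_lattice_def zero_less_power_int)
  show "Q \<in> lmeasurable" "measure lebesgue Q = (2 powi (- k)) ^ CARD('n)" "bounded Q"
    using cube_of_side_measure[OF c l] by auto
  then show "0 < measure lebesgue Q" using l by simp
qed

lemma cubes_measure:
  assumes "Q \<in> cubes D"
  shows "Q \<in> lmeasurable" "Q \<in> sets lebesgue" "bounded Q" "0 < measure lebesgue Q"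
  using assms dyadic_measure by (auto simp: cubes_def)

text \<open>Volume strictly decreases as the level grows, so a cube of a coarser level cannot fit
  inside one of a finer level.\<close>

lemma dyadic_level_mono:
  assumes "Q \<in> D j" "R \<in> D k" "Q \<subseteq> R"
  shows "k \<le> j"
proof (rule ccontr)
  assume "\<not> k \<le> j"
  then have "(2::real) powi (- k) < 2 powi (- j)" by (intro power_int_strict_increasing) auto
  then have "measure lebesgue R < measure lebesgue Q"
    using dyadic_measure(2)[OF assms(1)] dyadic_measure(2)[OF assms(2)]
    by (simp add: power_strict_mono zero_less_power_int)
  moreover have "measure lebesgue Q \<le> measure lebesgue R"
    using assms dyadic_measure(1) by (intro measure_mono_fmeasurable) auto
  ultimately show False by simp
qed

lemma dyadic_refines:
  assumes "k \<le> j"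
  shows "refines UNIV (D j) (D k)"
  using assms
proof (induction j rule: int_ge_induct)
  case base
  \<comment> \<open>Reflexivity of \<open>refines\<close> requires a partition; that
    \<open>D k\<close> is one is contained in the refinement by the next level.\<close>
  have "refines UNIV (D (k + 1)) (D k)" using D by (simp add: dyadic_lattice_def)
  then show ?case using refines_refl by (auto simp: refines_def)
next
  case (step i)
  then show ?case
    using D refines_trans unfolding dyadic_lattice_def by blast
qed

lemma dyadic_partition: "partition_on UNIV (D k)"
  using dyadic_refines[of k k] by (simp add: refines_def)

lemma dyadic_eqI:
  assumes "Q \<in> D k" "R \<in> D k" "x \<in> Q" "x \<in> R"
  shows "Q = R"
  using partition_onD2[OF dyadic_partition[of k]] assms by (auto simp: disjoint_def)

lemma dyadic_nested:
  assumes "Q \<in> D j" "R \<in> D k" "k \<le> j" "x \<in> Q" "x \<in> R"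
  shows "Q \<subseteq> R"
proof -
  obtain Y where "Y \<in> D k" "Q \<subseteq> Y"
    using dyadic_refines[OF assms(3)] assms(1) unfolding refines_def by blast
  then show ?thesis using dyadic_eqI assms by blast
qed

lemma dyadic_ancestor:
  assumes "Q \<in> D j" "k \<le> j"
  obtains R where "R \<in> D k" "Q \<subseteq> R"
  using dyadic_refines[OF assms(2)] assms(1) unfolding refines_def by blast

lemma dyadic_not_empty:
  assumes "Q \<in> D j"
  shows "Q \<noteq> {}"
  using dyadic_partition assms by (auto simp: partition_on_def)

section \<open>Levels, parents and children of dyadic cubes\<close>

lemma dyadic_level_unique:
  assumes "Q \<in> D j" "Q \<in> D k"
  shows "j = k"
  using dyadic_level_mono[of Q j Q k] dyadic_level_mono[of Q k Q j] assms by simp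

text \<open>\<open>parent\<close> is a least element for inclusion, so besides
  \<open>Q \<subset> R\<close> one needs that every cube strictly containing \<open>Q\<close>
  contains \<open>R\<close>. Such a cube has level at most \<open>k\<close>, since at level
  \<open>k + 1\<close> or finer it would lie inside \<open>Q\<close>; nestedness then gives the
  inclusion.\<close>

lemma parent_eq:
  assumes "Q \<in> D (k + 1)" "R \<in> D k" "Q \<subseteq> R"
  shows "parent D Q = R"
  unfolding parent_def
proof (rule Least_equality)
  have "Q \<noteq> R" using assms dyadic_level_unique[of Q k "k + 1"] by auto
  then show "R \<in> cubes D \<and> Q \<subset> R" using assms by (auto simp: cubes_def)
next
  fix S assume S: "S \<in> cubes D \<and> Q \<subset> S"
  then obtain j where j: "S \<in> D j" by (auto simp: cubes_def)
  obtain x where x: "x \<in> Q" using dyadic_not_empty assms by blast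
  have "j \<le> k"
  proof (rule ccontr)
    assume "\<not> j \<le> k"
    then have "S \<subseteq> Q" using dyadic_nested[OF j assms(1), of x] x S by auto
    then show False using S by auto
  qed
  then show "R \<le> S" using dyadic_nested[OF assms(2) j] x S assms(3) by auto
qed

lemma children_eq:
  assumes "Q \<in> D k"
  shows "children D Q = {R \<in> D (k + 1). R \<subseteq> Q}"
proof (intro equalityI subsetI)
  fix R assume "R \<in> children D Q"
  then obtain j where j: "R \<in> D j" "parent D R = Q" by (auto simp: children_def cubes_def)
  obtain S where S: "S \<in> D (j - 1)" "R \<subseteq> S" using dyadic_ancestor[OF j(1), of "j - 1"] by auto
  have "parent D R = S" using parent_eq[of R "j - 1" S] j S by simp
  then have "S = Q" using j by simp
  then have "j - 1 = k" using S(1) assms dyadic_level_unique by blast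
  then show "R \<in> {R \<in> D (k + 1). R \<subseteq> Q}" using j S \<open>S = Q\<close> by auto
next
  fix R assume "R \<in> {R \<in> D (k + 1). R \<subseteq> Q}"
  then show "R \<in> children D Q" using parent_eq assms by (auto simp: children_def cubes_def)
qed

lemma children_partition:
  assumes "Q \<in> cubes D"
  shows "partition_on Q (children D Q)"
proof -
  obtain k where k: "Q \<in> D k" using assms by (auto simp: cubes_def)
  show ?thesis
    unfolding children_eq[OF k] using refines_obtains_subset[OF dyadic_refines k, of "k+1"] by simp
qed

lemma children_psubset:
  assumes "Q \<in> cubes D" "R \<in> children D Q"
  shows "R \<in> cubes D" "R \<subset> Q"
proof -
  obtain k where k: "Q \<in> D k" using assms by (auto simp: cubes_def)
  show "R \<in> cubes D" using assms by (auto simp: children_def)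
  have "R \<noteq> Q"
    using assms(2) k dyadic_level_unique[of Q k "k + 1"] unfolding children_eq[OF k] by auto
  then show "R \<subset> Q" using assms(2) unfolding children_eq[OF k] by auto
qed

text \<open>The children are disjoint, each of volume \<open>2 ^ CARD('n)\<close> times smaller than
  that of \<open>Q\<close>. Arbitrary finite subfamilies are allowed because the formula serves both
  to count all children and to measure half of them.\<close>

lemma measure_Union_children:
  assumes "Q \<in> cubes D" "S \<subseteq> children D Q" "finite S"
  shows "\<Union>S \<in> lmeasurable"
    "measure lebesgue (\<Union>S) = real (card S) * (measure lebesgue Q / 2 ^ CARD('n))"
proof -
  obtain k where k: "Q \<in> D k" using assms by (auto simp: cubes_def)
  have Qm: "measure lebesgue Q = 2 ^ CARD('n) * (2 powi (- (k+1))) ^ CARD('n)"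
    unfolding dyadic_measure(2)[OF k]
    by (simp add: power_mult_distrib[symmetric] power_int_diff power_int_minus power_int_add)
  have m: "measure lebesgue R = measure lebesgue Q / 2 ^ CARD('n)" "R \<in> lmeasurable"
    if "R \<in> S" for R
    using that dyadic_measure[of R "k+1"] assms(2) unfolding Qm children_eq[OF k] by auto
  show "\<Union>S \<in> lmeasurable" using m assms(3) by auto
  have "disjoint S"
    using partition_onD2[OF children_partition[OF assms(1)]] assms(2) by (meson pairwise_subset)
  then have "measure lebesgue (\<Union>S) = (\<Sum>R\<in>S. measure lebesgue R)"
    using m(2) assms(3)
    by (intro measure_negligible_finite_Union) (auto simp: pairwise_def disjnt_def)
  then show "measure lebesgue (\<Union>S) = real (card S) * (measure lebesgue Q / 2 ^ CARD('n))"
    using m(1) by simp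
qed

text \<open>Counting by volume: \<open>2 ^ CARD('n) + 1\<close> children would together be larger
  than \<open>Q\<close>, so there are finitely many; as they fill \<open>Q\<close>, their exact
  number follows.\<close>

lemma children_card:
  assumes "Q \<in> cubes D"
  shows "finite (children D Q)" "card (children D Q) = 2 ^ CARD('n)"
proof -
  note Q0 = cubes_measure(4)[OF assms]
  show fin: "finite (children D Q)"
  proof (rule ccontr)
    assume "infinite (children D Q)"
    then obtain P where P: "P \<subseteq> children D Q" "finite P" "card P = 2 ^ CARD('n) + 1"
      using infinite_arbitrarily_large by metis
    have "measure lebesgue (\<Union>P) \<le> measure lebesgue Q"
      using children_psubset(2)[OF assms] P(1) measure_Union_children(1)[OF assms P(1,2)]
        cubes_measure(1)[OF assms]
      by (intro measure_mono_fmeasurable) auto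
    then show False using Q0 P(3) measure_Union_children(2)[OF assms P(1,2)]
      by (simp add: field_simps)
  qed
  have "real (card (children D Q)) * (measure lebesgue Q / 2 ^ CARD('n)) = measure lebesgue Q"
    using measure_Union_children(2)[OF assms subset_refl fin]
      partition_onD1[OF children_partition[OF assms]] by simp
  then have "real (card (children D Q)) = real (2 ^ CARD('n))"
    using Q0 by (simp add: field_simps)
  then show "card (children D Q) = 2 ^ CARD('n)" by (simp only: of_nat_eq_iff)
qed

end

section \<open>Paraproducts with balanced sign functions\<close>

text \<open>A property rather than a construction: which half of the children carries the sign 1
  stays open. The condition on \<bar>b\<bar> encodes both the support \<open>Q\<close> and the
  values 1 and -1 on it.\<close>

definition balanced_sign ::
  "(int \<Rightarrow> (real^'n) set set) \<Rightarrow> (real^'n) set \<Rightarrow> (real^'n \<Rightarrow> real) \<Rightarrow> bool" where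
  "balanced_sign D Q b \<longleftrightarrow> b \<in> borel_measurable lebesgue \<and> (\<forall>x. \<bar>b x\<bar> = indicator Q x) \<and>
     (\<forall>R\<in>children D Q. \<forall>x\<in>R. \<forall>y\<in>R. b x = b y) \<and> set_lebesgue_integral lebesgue Q b = 0"

text \<open>Meant for sums with a single nonzero term: the net of partial sums is constant as soon
  as the index set contains that term.\<close>

lemma finite_subsets_at_top_eventuallyI:
  assumes "i \<in> I" "\<And>F. finite F \<Longrightarrow> F \<subseteq> I \<Longrightarrow> i \<in> F \<Longrightarrow> P F"
  shows "eventually P (finite_subsets_at_top I)"
  unfolding eventually_finite_subsets_at_top
proof (intro exI[of _ "{i}"] conjI allI impI)
  show "{i} \<subseteq> I" using assms(1) by simp
  show "P F" if "finite F \<and> {i} \<subseteq> F \<and> F \<subseteq> I" for F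
    using assms(2)[of F] that by simp
qed simp

text \<open>Closed balls of integer radius exhaust the space, and a countable union of null sets is
  null. Set integrability supplies the measurability of \<open>h\<close> on each ball.\<close>

lemma AE_eq_zero_of_compact:
  fixes h :: "real^'n \<Rightarrow> real"
  assumes "\<And>K. compact K \<Longrightarrow> (\<integral>\<^sup>+x\<in>K. ennreal \<bar>h x\<bar> \<partial>lebesgue) = 0"
    and "\<And>K. compact K \<Longrightarrow> set_integrable lebesgue K h"
  shows "AE x in lebesgue. h x = 0"
proof -
  have "AE x in lebesgue. x \<in> cball 0 (real n) \<longrightarrow> h x = 0" for n
  proof -
    have "(\<lambda>x. ennreal \<bar>h x\<bar> * indicator (cball 0 (real n)) x)
        = (\<lambda>x. ennreal \<bar>indicator (cball 0 (real n)) x *\<^sub>R h x\<bar>)"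
      by (auto simp: indicator_def)
    moreover have "\<dots> \<in> borel_measurable lebesgue"
      using assms(2)[of "cball 0 (real n)"] unfolding set_integrable_def by measurable
    ultimately have "(\<lambda>x. ennreal \<bar>h x\<bar> * indicator (cball 0 (real n)) x) \<in> borel_measurable lebesgue"
      by simp
    then have "AE x in lebesgue. ennreal \<bar>h x\<bar> * indicator (cball 0 (real n)) x = 0"
      using assms(1)[of "cball 0 (real n)"] by (simp add: nn_integral_0_iff_AE)
    then show ?thesis by eventually_elim (auto simp: indicator_def)
  qed
  then have "AE x in lebesgue. \<forall>n::nat. x \<in> cball 0 (real n) \<longrightarrow> h x = 0"
    by (subst AE_all_countable) blast
  then show ?thesis
  proof eventually_elim
    case (elim x)
    obtain n where "norm x \<le> real n" using real_arch_simple by blast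
    then show ?case using elim by auto
  qed
qed

context
  fixes D :: "int \<Rightarrow> (real^'n) set set"
  assumes D: "dyadic_lattice D"
begin

lemma cubes_trichotomy:
  assumes "P \<in> cubes D" "Q \<in> cubes D" "P \<inter> Q \<noteq> {}"
  shows "P \<subset> Q \<or> Q \<subseteq> P"
proof -
  obtain j k x where jk: "P \<in> D j" "Q \<in> D k" "x \<in> P" "x \<in> Q"
    using assms by (auto simp: cubes_def)
  then show ?thesis
    using dyadic_nested[OF D jk(1,2) _ jk(3,4)] dyadic_nested[OF D jk(2,1) _ jk(4,3)]
    by (cases "k \<le> j") auto
qed

text \<open>Strict inclusion forces \<open>P\<close> to have level at least \<open>k + 1\<close>,
  where \<open>k\<close> is the level of \<open>Q\<close>; its ancestor of level
  \<open>k + 1\<close> is the desired child.\<close>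

lemma psubset_child:
  assumes "P \<in> cubes D" "Q \<in> cubes D" "P \<subset> Q"
  obtains R where "R \<in> children D Q" "P \<subseteq> R"
proof -
  obtain j k where jk: "P \<in> D j" "Q \<in> D k" using assms by (auto simp: cubes_def)
  obtain x where x: "x \<in> P" using dyadic_not_empty[OF D] jk by blast
  have "k < j"
  proof (rule ccontr)
    assume "\<not> k < j"
    then have "Q \<subseteq> P" using dyadic_nested[OF D jk(2,1), of x] x assms(3) by auto
    then show False using assms(3) by auto
  qed
  then obtain R where R: "R \<in> D (k + 1)" "P \<subseteq> R"
    using dyadic_ancestor[OF D jk(1), of "k+1"] by auto
  moreover have "R \<subseteq> Q" using dyadic_nested[OF D R(1) jk(2), of x] x R(2) assms(3) by auto
  ultimately show ?thesis using that[of R] by (simp add: children_eq[OF D jk(2)])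
qed

text \<open>Half of the children have a union \<open>A\<close> of measure \<bar>Q\<bar> / 2, so the
  function equal to 1 on \<open>A\<close> and -1 on \<open>Q - A\<close> has integral zero.\<close>

lemma balanced_sign_exists:
  assumes "Q \<in> cubes D"
  obtains b where "balanced_sign D Q b"
proof -
  note fin = children_card[OF D assms]
  have "2 ^ (CARD('n) - 1) \<le> card (children D Q)" unfolding fin(2) by (intro power_increasing) auto
  then obtain S where S: "S \<subseteq> children D Q" "card S = 2 ^ (CARD('n) - 1)"
    using obtain_subset_with_card_n by metis
  then have finS: "finite S" using fin(1) finite_subset by blast
  have half: "real (card S) / 2 ^ CARD('n) = 1 / 2"
    using power_minus_mult[of "CARD('n)" "2::real"] S(2) by (simp add: field_simps)
  define A where "A = \<Union>S"
  define b :: "real^'n \<Rightarrow> real" where "b = (\<lambda>x. 2 * indicator A x - indicator Q x)"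
  note QM = cubes_measure[OF D assms]
  have Am: "A \<in> lmeasurable" "measure lebesgue A = measure lebesgue Q / 2"
    using measure_Union_children[OF D assms S(1) finS] half by (auto simp: A_def field_simps)
  have AQ: "A \<subseteq> Q" using children_psubset[OF D assms] S(1) by (auto simp: A_def)
  have "set_lebesgue_integral lebesgue Q b
      = (\<integral>x. 2 * indicator A x - indicator Q x \<partial>lebesgue)"
    unfolding set_lebesgue_integral_def b_def
    by (intro Bochner_Integration.integral_cong) (use AQ in \<open>auto simp: indicator_def\<close>)
  also have "\<dots> = 2 * measure lebesgue A - measure lebesgue Q"
    using integrable_real_indicator[of A lebesgue] integrable_real_indicator[of Q lebesgue] Am(1) QM(1)
    by (subst Bochner_Integration.integral_diff) (auto simp: fmeasurable_def)
  finally have "set_lebesgue_integral lebesgue Q b = 0" using Am(2) by simp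
  moreover have "b x = b y" if R: "R \<in> children D Q" "x \<in> R" "y \<in> R" for R x y
  proof -
    \<comment> \<open>Distinct children are disjoint, so a child meets \<open>A\<close> only if it
      is one of the chosen ones, and then it lies in \<open>A\<close>.\<close>
    have "T = R" if "z \<in> R" "T \<in> S" "z \<in> T" for z T
      using disjointD[OF partition_onD2[OF children_partition[OF D assms]], of T R] S(1) R(1) that
      by blast
    then have "z \<in> A \<longleftrightarrow> R \<in> S" if "z \<in> R" for z
      using that unfolding A_def by blast
    then have "indicator A x = (indicator A y :: real)"
      using R(2,3) by (simp add: indicator_def)
    moreover have "x \<in> Q" "y \<in> Q" using R children_psubset(2)[OF D assms R(1)] by auto
    ultimately show ?thesis by (simp add: b_def)
  qed
  moreover have "b \<in> borel_measurable lebesgue"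
    using Am(1) QM(2) unfolding b_def by (auto simp: fmeasurable_def)
  moreover have "\<bar>b x\<bar> = indicator Q x" for x
    using AQ by (auto simp: b_def indicator_def)
  ultimately show ?thesis using that unfolding balanced_sign_def by blast
qed

section \<open>Averages, oscillations and martingale differences of a balanced sign function\<close>

context
  fixes Q :: "(real^'n) set" and b :: "real^'n \<Rightarrow> real"
  assumes Q: "Q \<in> cubes D" and b: "balanced_sign D Q b"
begin

lemma balanced_sign_outside: "x \<notin> Q \<Longrightarrow> b x = 0"
  using b unfolding balanced_sign_def by (metis abs_eq_0 indicator_simps(2))

lemma balanced_sign_locally_integrable: "locally_integrable b"
  unfolding locally_integrable_def
proof (intro allI impI)
  fix K :: "(real^'n) set" assume K: "compact K"
  have "integrable lebesgue (indicator K :: _ \<Rightarrow> real)"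
    using lmeasurable_compact[OF K] by (intro integrable_real_indicator) (auto simp: fmeasurable_def)
  then show "set_integrable lebesgue K b" unfolding set_integrable_def
  proof (rule Bochner_Integration.integrable_bound)
    show "(\<lambda>x. indicator K x *\<^sub>R b x) \<in> borel_measurable lebesgue"
      using b lmeasurable_compact[OF K]
      by (intro borel_measurable_scaleR borel_measurable_indicator)
         (auto simp: balanced_sign_def fmeasurable_def)
    have "\<bar>b x\<bar> \<le> 1" for x using b by (simp add: balanced_sign_def indicator_def)
    then show "AE x in lebesgue. norm (indicator K x *\<^sub>R b x) \<le> norm (indicator K x :: real)"
      by (auto simp: indicator_def)
  qed
qed

text \<open>Strictly inside \<open>Q\<close>, the cube \<open>P\<close> lies in one child, where
  \<open>b\<close> is constant, so \<open>b x\<close> is that constant for any \<open>x\<close> in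
  \<open>P\<close>. If \<open>P\<close> contains \<open>Q\<close>, the integral is the vanishing one
  over \<open>Q\<close>; if they are disjoint, \<open>b\<close> is zero on \<open>P\<close>.\<close>

lemma avg_balanced_sign:
  assumes P: "P \<in> cubes D" and x: "x \<in> P"
  shows "avg P b = (if P \<subset> Q then b x else 0)"
proof -
  consider "P \<subset> Q" | "Q \<subseteq> P" | "P \<inter> Q = {}" using cubes_trichotomy[OF P Q] by blast
  then show ?thesis
  proof cases
    case 1
    obtain R where R: "R \<in> children D Q" "P \<subseteq> R" using psubset_child[OF P Q 1] .
    have "b y = b x" if "y \<in> P" for y
      using b R x that unfolding balanced_sign_def by blast
    then have "set_lebesgue_integral lebesgue P b = (\<integral>y. b x * indicator P y \<partial>lebesgue)"
      unfolding set_lebesgue_integral_def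
      by (intro Bochner_Integration.integral_cong) (auto simp: indicator_def)
    also have "\<dots> = b x * measure lebesgue P"
      using cubes_measure(1)[OF D P] by (simp add: fmeasurable_def)
    finally show ?thesis using 1 cubes_measure(4)[OF D P] by (simp add: avg_def)
  next
    case 2
    have "set_lebesgue_integral lebesgue P b = set_lebesgue_integral lebesgue Q b"
      unfolding set_lebesgue_integral_def
      by (intro Bochner_Integration.integral_cong)
         (use 2 balanced_sign_outside in \<open>auto simp: indicator_def\<close>)
    also have "\<dots> = 0" using b by (simp only: balanced_sign_def)
    finally show ?thesis using 2 by (auto simp: avg_def)
  next
    case 3
    have "indicator P y *\<^sub>R b y = 0" for y
    proof (cases "y \<in> P")
      case True
      then have "y \<notin> Q" using 3 by blast
      then show ?thesis using balanced_sign_outside by simp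
    qed simp
    then have "set_lebesgue_integral lebesgue P b = 0"
      by (simp only: set_lebesgue_integral_def Bochner_Integration.integral_zero)
    then show ?thesis using 3 x by (auto simp: avg_def)
  qed
qed

text \<open>If \<open>P\<close> contains \<open>Q\<close>, the average is zero and \<bar>b\<bar> is
  the indicator of \<open>Q\<close>. Otherwise \<open>b\<close> is constant on \<open>P\<close> and
  equals its average there.\<close>

lemma oscillation_balanced_sign:
  assumes P: "P \<in> cubes D"
  shows "oscillation P b = (if Q \<subseteq> P then emeasure lebesgue Q else 0)"
proof -
  have eq: "ennreal \<bar>b x - avg P b\<bar> * indicator P x
      = (if Q \<subseteq> P then indicator Q x else 0)" for x
  proof (cases "x \<in> P")
    case True
    have "\<bar>b x\<bar> = indicator Q x" using b by (auto simp: balanced_sign_def)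
    then show ?thesis
      using avg_balanced_sign[OF P True] True cubes_trichotomy[OF P Q] 
      by (auto simp: indicator_def)
  qed (auto simp: indicator_def)
  show ?thesis unfolding oscillation_def eq using cubes_measure(2)[OF D Q] by simp
qed

text \<open>At a point of a child \<open>R\<close> of \<open>P\<close> this is the average over
  \<open>R\<close> minus that over \<open>P\<close>. The two agree unless \<open>R\<close> is
  strictly inside \<open>Q\<close> and \<open>P\<close> is not, which happens only for
  \<open>P = Q\<close>.\<close>

lemma mart_diff_balanced_sign:
  assumes P: "P \<in> cubes D"
  shows "mart_diff D P b x = (if P = Q then b x else 0)"
proof (cases "x \<in> P")
  case False
  then have "(\<Sum>R\<in>children D P. avg R b * indicator R x) = 0"
    using children_psubset(2)[OF D P] by (intro sum.neutral) (auto simp: indicator_def)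
  then show ?thesis
    using False balanced_sign_outside[of x] by (auto simp: mart_diff_def children_def)
next
  case True
  obtain R where R: "R \<in> children D P" "x \<in> R"
    using True partition_onD1[OF children_partition[OF D P]] by blast
  note R' = children_psubset[OF D P R(1)]
  have "(\<Sum>S\<in>children D P. avg S b * indicator S x) = (\<Sum>S\<in>children D P. if S = R then avg R b else 0)"
    using partition_onD2[OF children_partition[OF D P]] R
    by (intro sum.cong) (auto simp: disjoint_def indicator_def)
  also have "\<dots> = avg R b" using children_card(1)[OF D P] R(1) by simp
  finally have "mart_diff D P b x = avg R b - avg P b"
    using True by (simp add: mart_diff_def children_def)
  also have "\<dots> = (if R \<subset> Q then b x else 0) - (if P \<subset> Q then b x else 0)"
    using avg_balanced_sign[OF P True] avg_balanced_sign[OF R'(1) R(2)] by simp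
  also have "\<dots> = (if P = Q then b x else 0)"
  proof (cases "P = Q")
    case False
    \<comment> \<open>Otherwise \<open>Q\<close> is strictly inside \<open>P\<close>, hence inside a
      child of \<open>P\<close>; that child meets \<open>R\<close>, so it is \<open>R\<close>,
      contradicting \<open>R \<subset> Q\<close>.\<close>
    have "P \<subset> Q" if RQ: "R \<subset> Q"
    proof (rule ccontr)
      assume "\<not> P \<subset> Q"
      then have "Q \<subset> P" using cubes_trichotomy[OF P Q] True RQ R(2) False by blast
      then obtain S where S: "S \<in> children D P" "Q \<subseteq> S" using psubset_child[OF Q P] by blast
      then have "S = R"
        using partition_onD2[OF children_partition[OF D P]] R RQ by (auto simp: disjoint_def)
      then show False using S(2) RQ by auto
    qed
    then show ?thesis using False R' by auto
  qed (use R' in auto)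
  finally show ?thesis .
qed

section \<open>Convergence and value of the paraproduct\<close>

lemma paraproduct_sum_balanced_sign:
  assumes "finite F" "F \<subseteq> cubes D" "Q \<in> F"
  shows "(\<Sum>P\<in>F. paraproduct_term D b f P x) = b x * avg Q f"
proof -
  have "(\<Sum>P\<in>F. paraproduct_term D b f P x) = (\<Sum>P\<in>F. if P = Q then b x * avg Q f else 0)"
    using mart_diff_balanced_sign[of _ x] assms(2)
    by (intro sum.cong) (auto simp: paraproduct_term_def subset_iff)
  then show ?thesis using assms by simp
qed

lemma paraproduct_balanced_sign_sum:
  assumes "compact K"
  shows "has_unconditional_sum_L1 (cubes D) (paraproduct_term D b f) K (\<lambda>x. b x * avg Q f)"
  unfolding has_unconditional_sum_L1_def
proof (intro conjI ballI)
  have bK: "set_integrable lebesgue K b"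
    using balanced_sign_locally_integrable assms by (auto simp: locally_integrable_def)
  then show i: "set_integrable lebesgue K (\<lambda>x. b x * avg Q f)" by simp
  show "set_integrable lebesgue K (paraproduct_term D b f P)" if "P \<in> cubes D" for P
  proof -
    have "paraproduct_term D b f P = (if P = Q then (\<lambda>x. b x * avg Q f) else (\<lambda>x. 0))"
      using mart_diff_balanced_sign[OF that] by (auto simp: paraproduct_term_def)
    then show ?thesis using i by (simp add: set_integrable_def)
  qed
  show "((\<lambda>F. \<integral>\<^sup>+x\<in>K. ennreal \<bar>(\<Sum>P\<in>F. paraproduct_term D b f P x) - b x * avg Q f\<bar> \<partial>lebesgue)
      \<longlongrightarrow> 0) (finite_subsets_at_top (cubes D))"
    by (rule tendsto_eventually, rule finite_subsets_at_top_eventuallyI[OF Q])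
       (simp add: paraproduct_sum_balanced_sign)
qed

lemma paraproduct_well_defined_balanced_sign: "paraproduct_well_defined D b"
  using paraproduct_balanced_sign_sum unfolding paraproduct_well_defined_def by blast

text \<open>\<open>paraproduct\<close> is an arbitrary choice among representatives. The explicit
  function shows that one exists, and uniqueness of limits on every compact set identifies the
  chosen one almost everywhere.\<close>

lemma paraproduct_balanced_sign: "AE x in lebesgue. paraproduct D b f x = b x * avg Q f"
proof -
  define g where "g = paraproduct D b f"
  have sum: "has_unconditional_sum_L1 (cubes D) (paraproduct_term D b f) K g" if "compact K" for K
  proof -
    have "\<forall>K. compact K \<longrightarrow> has_unconditional_sum_L1 (cubes D) (paraproduct_term D b f) K g"
      unfolding g_def paraproduct_def
      by (rule someI[of _ "\<lambda>x. b x * avg Q f"]) (use paraproduct_balanced_sign_sum in blast)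
    then show ?thesis using that by blast
  qed
  have "AE x in lebesgue. b x * avg Q f - g x = 0"
  proof (rule AE_eq_zero_of_compact)
    fix K :: "(real^'n) set" assume K: "compact K"
    show "set_integrable lebesgue K (\<lambda>x. b x * avg Q f - g x)"
      using sum[OF K] paraproduct_balanced_sign_sum[OF K, of f]
      unfolding has_unconditional_sum_L1_def by (intro set_integral_diff) auto
    let ?I = "\<lambda>F. \<integral>\<^sup>+x\<in>K. ennreal \<bar>(\<Sum>P\<in>F. paraproduct_term D b f P x) - g x\<bar> \<partial>lebesgue"
    have "(?I \<longlongrightarrow> (\<integral>\<^sup>+x\<in>K. ennreal \<bar>b x * avg Q f - g x\<bar> \<partial>lebesgue))
        (finite_subsets_at_top (cubes D))"
      by (rule tendsto_eventually, rule finite_subsets_at_top_eventuallyI[OF Q])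
         (simp add: paraproduct_sum_balanced_sign)
    moreover have "(?I \<longlongrightarrow> 0) (finite_subsets_at_top (cubes D))"
      using sum[OF K] by (simp add: has_unconditional_sum_L1_def)
    ultimately show "(\<integral>\<^sup>+x\<in>K. ennreal \<bar>b x * avg Q f - g x\<bar> \<partial>lebesgue) = 0"
      using tendsto_unique finite_subsets_at_top_neq_bot by blast
  qed
  then show ?thesis unfolding g_def by eventually_elim simp
qed

end
end

section \<open>Masses and norms\<close>

lemma epowr_ennreal [simp]: "0 \<le> v \<Longrightarrow> epowr (ennreal v) a = ennreal (v powr a)"
  by (simp add: epowr_def)

lemma epowr_mono:
  assumes "x \<le> y" "0 \<le> a"
  shows "epowr x a \<le> epowr y a"
proof (cases "y = \<infinity>")
  case False
  then have "x \<noteq> \<infinity>" using assms(1) by (auto simp: top_unique)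
  moreover have "enn2real x \<le> enn2real y"
    using assms(1) False by (intro enn2real_mono) (auto simp: less_top)
  ultimately show ?thesis using False assms(2)
    by (simp add: epowr_def ennreal_leI powr_mono2)
qed (simp add: epowr_def)

text \<open>The function is the pointwise limit of its truncations to balls of integer radius, each
  of which is integrable.\<close>

lemma locally_integrable_measurable:
  assumes "locally_integrable f"
  shows "f \<in> borel_measurable lebesgue"
proof (rule borel_measurable_LIMSEQ_real)
  show "(\<lambda>x. indicator (cball 0 (real n)) x *\<^sub>R f x) \<in> borel_measurable lebesgue" for n
    using assms compact_cball unfolding locally_integrable_def set_integrable_def
    by (blast intro: borel_measurable_integrable)
  show "(\<lambda>n. indicator (cball 0 (real n)) x *\<^sub>R f x) \<longlonglongrightarrow> f x" for x
  proof (rule tendsto_eventually)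
    obtain N where N: "norm x \<le> real N" using real_arch_simple by blast
    show "\<forall>\<^sub>F n in sequentially. indicator (cball 0 (real n)) x *\<^sub>R f x = f x"
      using eventually_ge_at_top[of N] by eventually_elim (use N in auto)
  qed
qed

lemma weight_measurable: "weight w \<Longrightarrow> w \<in> borel_measurable lebesgue"
  by (simp add: weight_def locally_integrable_measurable)

lemma mass_mono: "A \<subseteq> B \<Longrightarrow> mass w A \<le> mass w B"
  unfolding mass_def by (intro nn_integral_mono) (auto simp: indicator_def)

lemma mass_Diff:
  assumes "w \<in> borel_measurable lebesgue" "A \<in> sets lebesgue" "B \<in> sets lebesgue"
    "A \<subseteq> B" "mass w A < \<infinity>"
  shows "mass w (B - A) = mass w B - mass w A"
proof -
  have "mass w E = emeasure (density lebesgue (\<lambda>x. ennreal (w x))) E" if "E \<in> sets lebesgue" for E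
    using that assms(1) by (simp add: mass_def emeasure_density)
  then show ?thesis using assms by (simp add: emeasure_Diff)
qed

lemma mass_weight_bounded:
  assumes "weight w" "bounded Q"
  shows "mass w Q < \<infinity>"
proof -
  have "set_integrable lebesgue (closure Q) w"
    using assms by (simp add: weight_def locally_integrable_def compact_closure)
  then have "(\<integral>\<^sup>+x. ennreal (norm (indicator (closure Q) x *\<^sub>R w x)) \<partial>lebesgue) < \<infinity>"
    unfolding set_integrable_def by (simp only: integrable_iff_bounded)
  moreover have "mass w Q \<le> (\<integral>\<^sup>+x. ennreal (norm (indicator (closure Q) x *\<^sub>R w x)) \<partial>lebesgue)"
    unfolding mass_def
    by (intro nn_integral_mono) (use assms(1) closure_subset in \<open>auto simp: indicator_def weight_def\<close>)
  ultimately show ?thesis by simp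
qed

lemma mass_weight_pos:
  assumes "weight w" "Q \<in> sets lebesgue" "0 < measure lebesgue Q"
  shows "0 < mass w Q"
proof (rule ccontr)
  assume "\<not> 0 < mass w Q"
  then have "(\<integral>\<^sup>+x. ennreal (w x) * indicator Q x \<partial>lebesgue) = 0" by (simp add: mass_def)
  then have "AE x in lebesgue. ennreal (w x) * indicator Q x = 0"
    using weight_measurable[OF assms(1)] assms(2) by (subst (asm) nn_integral_0_iff_AE) auto
  moreover have "ennreal (w x) \<noteq> 0" for x
    using assms(1) by (simp add: weight_def ennreal_eq_0_iff not_le)
  ultimately have "AE x in lebesgue. x \<notin> Q"
    by (auto simp: indicator_def)
  then have "emeasure lebesgue Q = 0"
    using assms(2) by (subst (asm) AE_iff_measurable[of Q]) auto
  then show False using assms(3) by (simp add: measure_def)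
qed

text \<open>The infimum defining \<open>op_norm\<close> must be shown to be an admissible constant
  for \<open>f\<close>. For positive norm of \<open>f\<close>, dividing by it turns every admissible
  \<open>N\<close> into an upper bound of the same quotient.\<close>

lemma op_norm_bound:
  assumes op: "op_norm T p \<mu> q lam \<le> ennreal K" and f: "f \<in> Linfty_c"
    and a: "Lp_norm p \<mu> f = ennreal a"
  shows "Lp_norm q lam (T f) \<le> ennreal K * ennreal a"
proof -
  define S where "S = {N. \<forall>f\<in>Linfty_c. Lp_norm q lam (T f) \<le> N * Lp_norm p \<mu> f}"
  have N: "Lp_norm q lam (T f) \<le> N * ennreal a" if "N \<in> S" for N
    using that f a by (auto simp: S_def)
  have InfS: "Inf S \<le> ennreal K" using op by (simp add: op_norm_def S_def)
  show ?thesis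
  proof (cases "ennreal a = 0")
    case True
    \<comment> \<open>The infimum of the empty set is \<infinity>, so the finite bound guarantees an
      admissible \<open>N\<close>, which makes the left-hand side zero.\<close>
    have "S \<noteq> {}" using InfS by (auto simp: top_unique)
    then show ?thesis using N True by fastforce
  next
    case False
    then have "Lp_norm q lam (T f) / ennreal a \<le> N" if "N \<in> S" for N
      using N[OF that] by (intro divide_le_posI_ennreal) (auto simp: mult.commute zero_less_iff_neq_zero)
    then have "Lp_norm q lam (T f) / ennreal a \<le> ennreal K"
      using InfS by (meson Inf_greatest order_trans)
    then have "Lp_norm q lam (T f) / ennreal a * ennreal a \<le> ennreal K * ennreal a"
      by (intro mult_right_mono) auto
    then show ?thesis using False by (simp add: ennreal_divide_times divide_mult_eq)
  qed
qed

text \<open>The left-hand side is a rectangle under the graph of \<open>t powr (-r)\<close> between \<open>x\<close> and \<open>y\<close>.\<close>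
lemma powr_rectangle_le:
  fixes x y r :: real
  assumes "0 < x" "x \<le> y" "1 < r"
  shows "y powr (- r) * (y - x) \<le> (x powr (1 - r) - y powr (1 - r)) / (r - 1)"
proof -
  have y: "0 < y" using assms by simp
  \<comment> \<open>With \<open>z = x / y\<close>, multiply \<open>ln z \<le> z - 1\<close> by the
    negative number \<open>1 - r\<close> and apply \<open>1 + w \<le> exp w\<close>.\<close>
  have t: "1 + (r - 1) * (1 - x / y) \<le> (x / y) powr (1 - r)"
  proof -
    have "ln (x / y) \<le> x / y - 1" using assms y by (intro ln_le_minus_one) auto
    then have "(r - 1) * (1 - x / y) \<le> (1 - r) * ln (x / y)"
      using mult_left_mono[of "ln (x / y)" "x / y - 1" "r - 1"] assms(3) by (simp add: algebra_simps)
    then have "1 + (r - 1) * (1 - x / y) \<le> exp ((1 - r) * ln (x / y))"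
      by (rule order_trans[OF add_left_mono exp_ge_add_one_self])
    then show ?thesis using assms y by (simp add: powr_def)
  qed
  have "y powr (1 - r) = y powr (- r) * y"
    using y powr_add[of y "- r" 1] by simp
  then have "(r - 1) * (y powr (- r) * (y - x)) = y powr (1 - r) * ((r - 1) * (1 - x / y))"
    using y by (simp add: field_simps)
  also have "\<dots> \<le> y powr (1 - r) * ((x / y) powr (1 - r) - 1)"
    using t by (intro mult_left_mono) auto
  also have "\<dots> = x powr (1 - r) - y powr (1 - r)"
    using assms y by (simp add: powr_divide algebra_simps)
  finally show ?thesis using assms(3) by (simp add: field_simps)
qed

text \<open>The first term is \<open>v 0 powr (1 - r)\<close>; the others are rectangles whose
  bounds telescope to at most \<open>1 / (r - 1)\<close> times this. The constant is
  \<open>1 + 1 / (r - 1)\<close>.\<close>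

lemma sum_powr_telescope:
  fixes v :: "nat \<Rightarrow> real"
  assumes v: "\<And>j. 0 < v j" "\<And>j. v j \<le> v (Suc j)" and r: "1 < r"
  shows "(\<Sum>j<n. v j powr (- r) * (if j = 0 then v 0 else v j - v (j - 1)))
    \<le> r / (r - 1) * v 0 powr (1 - r)"
proof -
  let ?t = "\<lambda>j. v j powr (- r) * (if j = 0 then v 0 else v j - v (j - 1))"
  \<comment> \<open>The negative term at \<open>v n\<close> is kept so that the induction closes; it
    is dropped only afterwards.\<close>
  have "(\<Sum>j<Suc n. ?t j) \<le> v 0 powr (1 - r) + (v 0 powr (1 - r) - v n powr (1 - r)) / (r - 1)" for n
  proof (induction n)
    case 0
    have "v 0 powr (1 - r) = v 0 powr (- r) * v 0"
      using v(1)[of 0] powr_add[of "v 0" "- r" 1] by simp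
    then show ?case by simp
  next
    case (Suc n)
    have "?t (Suc n) \<le> (v n powr (1 - r) - v (Suc n) powr (1 - r)) / (r - 1)"
      using powr_rectangle_le[OF v(1) v(2) r, of n] by simp
    then show ?case using Suc by (simp add: diff_divide_distrib)
  qed
  moreover have "v 0 powr (1 - r) + (v 0 powr (1 - r) - v n powr (1 - r)) / (r - 1)
      \<le> r / (r - 1) * v 0 powr (1 - r)" for n
  proof -
    have "r / (r - 1) = 1 + 1 / (r - 1)" using r by (simp add: field_simps)
    then have "r / (r - 1) * v 0 powr (1 - r) = v 0 powr (1 - r) + v 0 powr (1 - r) / (r - 1)"
      by (simp only: distrib_right) simp
    then show ?thesis using r by (simp add: diff_divide_distrib)
  qed
  ultimately have Suc: "(\<Sum>j<Suc n. ?t j) \<le> r / (r - 1) * v 0 powr (1 - r)" for n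
    using order_trans by blast
  show ?thesis
  proof (cases n)
    case 0
    then show ?thesis using r by simp
  qed (use Suc in blast)
qed

section \<open>Norms of balanced sign functions\<close>

context
  fixes D :: "int \<Rightarrow> (real^'n) set set" and Q :: "(real^'n) set" and b \<nu> :: "real^'n \<Rightarrow> real"
    and v :: real
  assumes D: "dyadic_lattice D" and Q: "Q \<in> cubes D" and b: "balanced_sign D Q b"
    and \<nu>: "weight \<nu>" and v: "0 < v" "mass \<nu> Q = ennreal v"
begin

text \<open>Only cubes containing \<open>Q\<close> have nonzero oscillation. It is the same for all
  of them, and among them \<open>Q\<close> has the least mass.\<close>

lemma BMO_norm_balanced_sign:
  assumes s: "1 + \<alpha> / real CARD('n) = s" "0 < s"
  shows "BMO_norm D \<alpha> \<nu> b \<le> ennreal (measure lebesgue Q * v powr (- s))"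
  unfolding BMO_norm_def
proof (rule SUP_least)
  fix P assume P: "P \<in> cubes D"
  show "oscillation P b / epowr (mass \<nu> P) (1 + \<alpha> / real CARD('n))
    \<le> ennreal (measure lebesgue Q * v powr (- s))"
  proof (cases "Q \<subseteq> P")
    case True
    have "mass \<nu> P < \<infinity>" using mass_weight_bounded[OF \<nu> cubes_measure(3)[OF D P]] .
    then obtain w where w: "0 \<le> w" "mass \<nu> P = ennreal w" by (cases "mass \<nu> P") auto
    have vw: "v \<le> w" using mass_mono[OF True, of \<nu>] w v by simp
    have "oscillation P b = ennreal (measure lebesgue Q)"
      using True oscillation_balanced_sign[OF D Q b P]
        emeasure_eq_measure2[OF cubes_measure(1)[OF D Q]] by simp
    then have "oscillation P b / epowr (mass \<nu> P) (1 + \<alpha> / real CARD('n))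
        = ennreal (measure lebesgue Q / w powr s)"
      using w vw v s by (simp add: divide_ennreal)
    also have "\<dots> \<le> ennreal (measure lebesgue Q / v powr s)"
      using vw v s by (intro ennreal_leI divide_left_mono powr_mono2) auto
    finally show ?thesis by (simp add: powr_minus divide_inverse)
  next
    case False
    then show ?thesis using oscillation_balanced_sign[OF D Q b P] by simp
  qed
qed

text \<open>On the shell between consecutive ancestors of \<open>Q\<close> the sharp maximal
  function is at most \<bar>Q\<bar> divided by the mass of the outer ancestor. Integrating its power
  \<open>r\<close> shell by shell gives the sum bounded by
  \<open>sum_powr_telescope\<close>.\<close>

lemma sharp_maximal_balanced_sign:
  assumes r: "1 < r"
  shows "eLp_norm r \<nu> (sharp_maximal D \<nu> b)
    \<le> ennreal ((r / (r - 1)) powr (1 / r) * (measure lebesgue Q * v powr (- (1 - 1 / r))))"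
proof -
  define m where "m = measure lebesgue Q"
  have m: "0 < m" "emeasure lebesgue Q = ennreal m"
    using cubes_measure(4)[OF D Q] emeasure_eq_measure2[OF cubes_measure(1)[OF D Q]]
    by (simp_all add: m_def)
  obtain k where k: "Q \<in> D k" using Q by (auto simp: cubes_def)
  \<comment> \<open>\<open>P j\<close> is the ancestor of \<open>Q\<close> that lies
    \<open>j\<close> generations above it.\<close>
  have "\<exists>R. R \<in> D (k - int j) \<and> Q \<subseteq> R" for j
    by (rule dyadic_ancestor[OF D k, of "k - int j"]) auto
  then obtain P where P: "\<And>j. P j \<in> D (k - int j)" "\<And>j. Q \<subseteq> P j" by metis
  have Pc: "P j \<in> cubes D" for j using P(1) by (auto simp: cubes_def)
  obtain x0 where x0: "x0 \<in> Q" using dyadic_not_empty[OF D k] by blast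
  have P0: "P 0 = Q" using dyadic_eqI[OF D _ k, of "P 0" x0] P[of 0] x0 by auto
  have Pmono: "P i \<subseteq> P j" if "i \<le> j" for i j
    using dyadic_nested[OF D P(1) P(1), of j i x0] P(2) x0 that by auto
  have anc: "\<exists>j. R = P j" if R: "R \<in> cubes D" "Q \<subseteq> R" for R
  proof -
    obtain i where i: "R \<in> D i" using R by (auto simp: cubes_def)
    have "i \<le> k" using dyadic_level_mono[OF D k i R(2)] .
    then have "R = P (nat (k - i))"
      using dyadic_eqI[OF D i, of "P (nat (k - i))" x0] P[of "nat (k - i)"] x0 R(2) by auto
    then show ?thesis by blast
  qed
  define u where "u = (\<lambda>j. enn2real (mass \<nu> (P j)))"
  have fin: "mass \<nu> (P j) < \<infinity>" for j using mass_weight_bounded[OF \<nu> cubes_measure(3)[OF D Pc]] .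
  then have u: "mass \<nu> (P j) = ennreal (u j)" for j by (simp add: u_def ennreal_enn2real)
  have u_mono: "u i \<le> u j" if "i \<le> j" for i j
    unfolding u_def using mass_mono[OF Pmono[OF that], of \<nu>] fin[of j] by (intro enn2real_mono) auto
  have u0: "u 0 = v" using v by (simp add: u_def P0)
  then have u_pos: "0 < u j" for j using u_mono[of 0 j] v by simp
  have increment: "0 \<le> (if j = 0 then u 0 else u j - u (j - 1))" for j
    using u_pos[of 0] u_mono[of "j - 1" j] by simp
  define A where "A = (\<lambda>j. if j = 0 then P 0 else P j - P (j - 1))"
  have A_sets: "A j \<in> sets lebesgue" for j using cubes_measure(2)[OF D Pc] by (auto simp: A_def)
  have mass_A: "mass \<nu> (A j) = ennreal (if j = 0 then u 0 else u j - u (j - 1))" for j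
  proof (cases j)
    case (Suc i)
    have "mass \<nu> (P (Suc i) - P i) = mass \<nu> (P (Suc i)) - mass \<nu> (P i)"
      using weight_measurable[OF \<nu>] cubes_measure(2)[OF D Pc] Pmono fin by (intro mass_Diff) auto
    then show ?thesis using Suc u_pos[of i] by (simp add: A_def u ennreal_minus)
  qed (simp add: A_def u)
  \<comment> \<open>The majorant is constant on each shell \<open>A j\<close>, with
    \<open>m / u j\<close> the largest quotient among the ancestors containing the shell.\<close>
  let ?f = "\<lambda>j x. ennreal ((m / u j) powr r) * indicator (A j) x"
  have sharp: "epowr (sharp_maximal D \<nu> b x) r \<le> (\<Sum>j. ?f j x)" for x
  proof (cases "\<exists>j. x \<in> P j")
    case True
    define j where "j = (LEAST j. x \<in> P j)"
    have j: "x \<in> P j" "\<And>i. x \<in> P i \<Longrightarrow> j \<le> i"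
      using True LeastI_ex[of "\<lambda>j. x \<in> P j"] Least_le[of "\<lambda>j. x \<in> P j"] by (auto simp: j_def)
    have xA: "x \<in> A j" using j by (cases j) (force simp: A_def)+
    have "sharp_maximal D \<nu> b x \<le> ennreal (m / u j)"
      unfolding sharp_maximal_def
    proof (rule SUP_least)
      fix R assume R: "R \<in> cubes D"
      show "indicator R x / mass \<nu> R * oscillation R b \<le> ennreal (m / u j)"
      proof (cases "Q \<subseteq> R \<and> x \<in> R")
        case True
        then obtain i where i: "R = P i" using anc[OF R] by blast
        have "u j \<le> u i" using True i j(2) u_mono by simp
        then have "1 / u i * m \<le> m / u j"
          using u_pos[of j] u_pos[of i] m by (simp add: frac_le)
        moreover have "indicator R x / mass \<nu> R * oscillation R b = ennreal (1 / u i) * ennreal m"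
          using True oscillation_balanced_sign[OF D Q b R] m(2) u_pos[of i]
          by (simp add: i u divide_ennreal flip: ennreal_1)
        ultimately show ?thesis
          using m(1) u_pos[of i] by (simp add: ennreal_leI flip: ennreal_mult)
      next
        case False
        then show ?thesis using oscillation_balanced_sign[OF D Q b R] by (auto simp: indicator_def)
      qed
    qed
    then have "epowr (sharp_maximal D \<nu> b x) r \<le> epowr (ennreal (m / u j)) r"
      using r by (intro epowr_mono) auto
    also have "\<dots> = (\<Sum>i\<in>{j}. ?f i x)"
      using m u_pos[of j] xA by simp
    also have "\<dots> \<le> (\<Sum>i. ?f i x)"
      by (rule sum_le_suminf) auto
    finally show ?thesis .
  next
    case False
    \<comment> \<open>The ancestors of \<open>Q\<close> may fail to exhaust the space. Every cube
      through a point outside all of them misses part of \<open>Q\<close> and has oscillation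
      zero.\<close>
    have "sharp_maximal D \<nu> b x \<le> 0"
      unfolding sharp_maximal_def
    proof (rule SUP_least)
      fix R assume R: "R \<in> cubes D"
      show "indicator R x / mass \<nu> R * oscillation R b \<le> 0"
        using oscillation_balanced_sign[OF D Q b R] anc[OF R] False by (auto simp: indicator_def)
    qed
    then show ?thesis by (simp add: epowr_def)
  qed
  have "(\<integral>\<^sup>+x. epowr (sharp_maximal D \<nu> b x) r * ennreal (\<nu> x) \<partial>lebesgue)
      \<le> (\<integral>\<^sup>+x. (\<Sum>j. ?f j x * ennreal (\<nu> x)) \<partial>lebesgue)"
    using sharp by (intro nn_integral_mono) (simp only: ennreal_suminf_multc mult_right_mono zero_le)
  also have "\<dots> = (\<Sum>j. \<integral>\<^sup>+x. ?f j x * ennreal (\<nu> x) \<partial>lebesgue)"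
    using A_sets weight_measurable[OF \<nu>] by (intro nn_integral_suminf) auto
  also have "\<dots> = (\<Sum>j. ennreal ((m / u j) powr r) * mass \<nu> (A j))"
  proof (intro suminf_cong)
    fix j
    have "(\<integral>\<^sup>+x. ?f j x * ennreal (\<nu> x) \<partial>lebesgue)
        = (\<integral>\<^sup>+x. ennreal ((m / u j) powr r) * (ennreal (\<nu> x) * indicator (A j) x) \<partial>lebesgue)"
      by (simp only: mult.assoc mult.commute[of "indicator _ _"])
    also have "\<dots> = ennreal ((m / u j) powr r) * mass \<nu> (A j)"
      unfolding mass_def using A_sets weight_measurable[OF \<nu>] by (intro nn_integral_cmult) auto
    finally show "(\<integral>\<^sup>+x. ?f j x * ennreal (\<nu> x) \<partial>lebesgue)
        = ennreal ((m / u j) powr r) * mass \<nu> (A j)" .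
  qed
  also have "\<dots> = (\<Sum>j. ennreal (m powr r * (u j powr (- r) * (if j = 0 then u 0 else u j - u (j - 1)))))"
  proof (intro suminf_cong)
    fix j
    have "(m / u j) powr r = m powr r * u j powr (- r)"
      using m u_pos[of j] by (simp add: powr_divide powr_minus_divide)
    then show "ennreal ((m / u j) powr r) * mass \<nu> (A j)
        = ennreal (m powr r * (u j powr (- r) * (if j = 0 then u 0 else u j - u (j - 1))))"
      unfolding mass_A by (simp only: ennreal_mult powr_ge_zero increment mult.assoc mult_nonneg_nonneg)
  qed
  also have "\<dots> \<le> ennreal (m powr r * (r / (r - 1) * v powr (1 - r)))"
  proof (rule suminf_le_const)
    fix n
    have "(\<Sum>j<n. ennreal (m powr r * (u j powr (- r) * (if j = 0 then u 0 else u j - u (j - 1)))))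
      = ennreal (m powr r * (\<Sum>j<n. u j powr (- r) * (if j = 0 then u 0 else u j - u (j - 1))))"
      unfolding sum_distrib_left
      by (rule sum_ennreal) (intro mult_nonneg_nonneg powr_ge_zero increment)
    also have "\<dots> \<le> ennreal (m powr r * (r / (r - 1) * v powr (1 - r)))"
      using sum_powr_telescope[of u r n] u_pos u_mono r u0
      by (intro ennreal_leI mult_left_mono) auto
    finally show "(\<Sum>j<n. ennreal (m powr r * (u j powr (- r) * (if j = 0 then u 0 else u j - u (j - 1)))))
      \<le> ennreal (m powr r * (r / (r - 1) * v powr (1 - r)))" .
  qed simp
  finally have "eLp_norm r \<nu> (sharp_maximal D \<nu> b)
      \<le> epowr (ennreal (m powr r * (r / (r - 1) * v powr (1 - r)))) (1 / r)"
    unfolding eLp_norm_def using r by (intro epowr_mono) auto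
  also have "\<dots> = ennreal ((m powr r * (r / (r - 1) * v powr (1 - r))) powr (1 / r))"
    using r by simp
  also have "(m powr r * (r / (r - 1) * v powr (1 - r))) powr (1 / r)
      = (r / (r - 1)) powr (1 / r) * (m * v powr (- (1 - 1 / r)))"
  proof -
    have e: "(1 - r) * (1 / r) = - (1 - 1 / r)" "r * (1 / r) = 1" using r by (auto simp: field_simps)
    show ?thesis using r m v by (simp only: powr_mult powr_powr e) (simp add: ac_simps)
  qed
  finally show ?thesis by (simp add: m_def)
qed

end

section \<open>Testing on truncated dual weights\<close>

lemma conjugate_exponent_eq:
  fixes p p' :: real
  assumes "1 < p" "1 / p + 1 / p' = 1"
  shows "p' = p / (p - 1)"
proof -
  have "1 / p' = (p - 1) / p" using assms by (simp add: diff_divide_distrib)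
  then have "inverse (1 / p') = inverse ((p - 1) / p)" by (rule arg_cong)
  then show ?thesis by simp
qed

context
  fixes D :: "int \<Rightarrow> (real^'n) set set" and Q :: "(real^'n) set"
    and b \<mu> lam \<mu>' :: "real^'n \<Rightarrow> real" and p p' q K l m :: real
  assumes D: "dyadic_lattice D" and Q: "Q \<in> cubes D" and b: "balanced_sign D Q b"
    and p: "1 < p" "1 / p + 1 / p' = 1" and q: "0 < q"
    and \<mu>: "weight \<mu>" and lam: "lam \<in> borel_measurable lebesgue"
    and \<mu>': "\<And>x. \<mu>' x = \<mu> x powr (- (p' / p))"
    and l: "0 < l" "mass lam Q = ennreal l" and m: "m = measure lebesgue Q"
    and K: "0 \<le> K" and op: "op_norm (paraproduct D b) p \<mu> q lam \<le> ennreal K"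
begin

text \<open>The paraproduct is almost everywhere \<open>b\<close> times the constant
  \<open>avg Q f\<close>, and \<bar>b\<bar> is the indicator of \<open>Q\<close>.\<close>

lemma Lp_norm_paraproduct_balanced_sign:
  "Lp_norm q lam (paraproduct D b f) = ennreal (\<bar>avg Q f\<bar> * l powr (1 / q))"
proof -
  have "(\<integral>\<^sup>+x. epowr (ennreal \<bar>paraproduct D b f x\<bar>) q * ennreal (lam x) \<partial>lebesgue)
      = (\<integral>\<^sup>+x. ennreal (\<bar>avg Q f\<bar> powr q) * (ennreal (lam x) * indicator Q x) \<partial>lebesgue)"
  proof (rule nn_integral_cong_AE)
    have "\<bar>b x\<bar> = indicator Q x" for x using b by (simp only: balanced_sign_def)
    then have e: "\<bar>b x * avg Q f\<bar> = indicator Q x * \<bar>avg Q f\<bar>" for x by (simp only: abs_mult)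
    show "AE x in lebesgue. epowr (ennreal \<bar>paraproduct D b f x\<bar>) q * ennreal (lam x)
        = ennreal (\<bar>avg Q f\<bar> powr q) * (ennreal (lam x) * indicator Q x)"
      using paraproduct_balanced_sign[OF D Q b, of f]
    proof eventually_elim
      case (elim x)
      show ?case unfolding elim e by (cases "x \<in> Q") (simp_all add: mult.commute epowr_def)
    qed
  qed
  also have "\<dots> = ennreal (\<bar>avg Q f\<bar> powr q) * mass lam Q"
    unfolding mass_def using lam cubes_measure(2)[OF D Q] by (intro nn_integral_cmult) auto
  also have "\<dots> = ennreal (\<bar>avg Q f\<bar> powr q * l)"
    using l by (simp add: ennreal_mult)
  finally have "Lp_norm q lam (paraproduct D b f) = ennreal ((\<bar>avg Q f\<bar> powr q * l) powr (1 / q))"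
    using l by (simp add: Lp_norm_def eLp_norm_def)
  also have "(\<bar>avg Q f\<bar> powr q * l) powr (1 / q) = \<bar>avg Q f\<bar> * l powr (1 / q)"
    using l q by (simp add: powr_mult powr_powr)
  finally show ?thesis .
qed

text \<open>Truncating the dual weight gives admissible test functions although \<open>\<mu>'\<close> need not be
  locally integrable.\<close>
lemma mass_truncated_dual_weight:
  fixes n :: nat
  defines "E \<equiv> Q \<inter> {x. \<mu>' x \<le> real n}"
  shows "mass \<mu>' E \<le> ennreal ((K * m / l powr (1 / q)) powr p')"
proof -
  have \<mu>pos: "0 < \<mu> x" for x using \<mu> by (simp add: weight_def)
  have \<mu>'pos: "0 < \<mu>' x" for x using \<mu>pos[of x] by (simp add: \<mu>')
  note p'_eq = conjugate_exponent_eq[OF p]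
  have p': "1 < p'" using p(1) by (simp add: p'_eq)
  note [measurable] = weight_measurable[OF \<mu>]
  have \<mu>'m [measurable]: "\<mu>' \<in> borel_measurable lebesgue"
    unfolding \<mu>' by measurable
  note Qs [measurable] = cubes_measure(2)[OF D Q]
  have Em [measurable]: "E \<in> sets lebesgue"
  proof -
    have "{x \<in> space lebesgue. \<mu>' x \<le> real n} \<in> sets lebesgue" by measurable
    then show ?thesis using Qs by (simp add: E_def)
  qed
  \<comment> \<open>The extremal function of the duality pairing, cut off where \<mu>' is large so
    that it is bounded.\<close>
  define f where "f = (\<lambda>x. \<mu>' x * indicator E x)"
  have fm [measurable]: "f \<in> borel_measurable lebesgue" unfolding f_def by measurable
  have fb: "0 \<le> f x" "f x \<le> real n" for x
    using \<mu>'pos[of x] by (auto simp: f_def E_def indicator_def)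
  have f: "f \<in> Linfty_c"
    unfolding Linfty_c_def
  proof (intro CollectI conjI)
    show "bounded (range f)" using fb by (intro boundedI[of _ "real n"]) auto
    have "compact (closure Q)" using cubes_measure(3)[OF D Q] by (simp add: compact_closure)
    moreover have "f x = 0" if "x \<notin> closure Q" for x
      using that closure_subset[of Q] by (auto simp: f_def E_def indicator_def)
    ultimately show "\<exists>K. compact K \<and> (\<forall>x. x \<notin> K \<longrightarrow> f x = 0)" by blast
  qed (rule fm)
  have massE: "mass \<mu>' E = (\<integral>\<^sup>+x. ennreal (f x) \<partial>lebesgue)"
    unfolding mass_def f_def by (intro nn_integral_cong) (simp add: indicator_def)
  have "mass \<mu>' E \<le> (\<integral>\<^sup>+x. ennreal (real n) * indicator Q x \<partial>lebesgue)"
    unfolding mass_def by (intro nn_integral_mono) (auto simp: E_def indicator_def intro!: ennreal_leI)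
  also have "\<dots> = ennreal (real n) * emeasure lebesgue Q" using Qs by (simp add: nn_integral_cmult_indicator)
  also have "\<dots> < \<infinity>"
    unfolding emeasure_eq_measure2[OF cubes_measure(1)[OF D Q]] by (simp add: ennreal_mult_less_top)
  \<comment> \<open>The truncation makes this mass finite, so that a power of it can be cancelled
    below.\<close>
  finally obtain a where a: "0 \<le> a" "mass \<mu>' E = ennreal a" by (cases "mass \<mu>' E") auto
  have m0: "0 < m" using cubes_measure(4)[OF D Q] m by simp
  have "set_lebesgue_integral lebesgue Q f = (\<integral>x. f x \<partial>lebesgue)"
    unfolding set_lebesgue_integral_def
    by (intro Bochner_Integration.integral_cong) (auto simp: f_def E_def indicator_def)
  also have "\<dots> = a"
    using a massE fb by (subst integral_eq_nn_integral) auto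
  finally have avg: "avg Q f = a / m" by (simp add: avg_def m)
  \<comment> \<open>Since \<open>p' = p' / p + 1\<close>, the power \<open>p\<close> of \<mu>' times
    \<mu> is again \<mu>'. Hence \<open>a\<close> is at once the integral of \<open>f\<close> and
    the power \<open>p\<close> of its norm.\<close>
  have "epowr (ennreal \<bar>f x\<bar>) p * ennreal (\<mu> x) = ennreal (\<mu>' x) * indicator E x" for x
  proof (cases "x \<in> E")
    case True
    have "- (p' / p) * p + 1 = - (p' / p)" using p(1) by (simp add: p'_eq field_simps)
    then have "\<mu>' x powr p * \<mu> x = \<mu>' x"
      using \<mu>pos[of x] powr_add[of "\<mu> x" "- (p' / p) * p" 1] unfolding \<mu>' powr_powr by simp
    then show ?thesis using True \<mu>'pos[of x] \<mu>pos[of x] by (simp add: f_def flip: ennreal_mult)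
  qed (simp add: f_def epowr_def)
  then have Lp: "Lp_norm p \<mu> f = ennreal (a powr (1 / p))"
    using a by (simp add: Lp_norm_def eLp_norm_def flip: mass_def)
  have "ennreal (\<bar>a / m\<bar> * l powr (1 / q)) \<le> ennreal K * ennreal (a powr (1 / p))"
    using op_norm_bound[OF op f Lp] by (simp only: Lp_norm_paraproduct_balanced_sign avg)
  then have "a / m * l powr (1 / q) \<le> K * a powr (1 / p)"
    using a m0 K l(1) by (simp flip: ennreal_mult)
  then have *: "a * l powr (1 / q) \<le> (K * m) * a powr (1 / p)"
    using m0 by (simp add: field_simps)
  have "a \<le> (K * m / l powr (1 / q)) powr p'"
  proof (cases "a = 0")
    case False
    then have a0: "0 < a" using a by simp
    have e: "a powr (1 / p') * a powr (1 / p) = a"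
      using a0 p(2) by (simp flip: powr_add add: add.commute)
    have "(a powr (1 / p') * l powr (1 / q)) * a powr (1 / p)
        = (a powr (1 / p') * a powr (1 / p)) * l powr (1 / q)"
      by (simp only: mult.assoc mult.commute mult.left_commute)
    then have "(a powr (1 / p') * l powr (1 / q)) * a powr (1 / p) \<le> (K * m) * a powr (1 / p)"
      using * by (simp only: e)
    then have "a powr (1 / p') \<le> K * m / l powr (1 / q)"
      using a0 l(1) by (simp add: field_simps)
    then have "(a powr (1 / p')) powr p' \<le> (K * m / l powr (1 / q)) powr p'"
      using p' by (intro powr_mono2) auto
    then show ?thesis using a0 p' by (simp add: powr_powr)
  qed simp
  then show ?thesis unfolding a(2) by (rule ennreal_leI)
qed

text \<open>The bound for truncations is uniform in \<open>n\<close>, so monotone convergence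
  carries it to all of \<open>Q\<close>; finiteness of the mass of \<mu>' is part of the
  conclusion.\<close>

lemma dual_weight_mass_le:
  obtains u where "0 \<le> u" "mass \<mu>' Q = ennreal u" "u powr (1 / p') * l powr (1 / q) \<le> K * m"
proof -
  let ?E = "\<lambda>n::nat. Q \<inter> {x. \<mu>' x \<le> real n}"
  let ?T = "K * m / l powr (1 / q)"
  have p': "0 < p'" using p(1) by (simp add: conjugate_exponent_eq[OF p])
  have T: "0 \<le> ?T" using K m by simp
  have \<mu>'m [measurable]: "\<mu>' \<in> borel_measurable lebesgue"
    unfolding \<mu>' using weight_measurable[OF \<mu>] by measurable
  note Qs [measurable] = cubes_measure(2)[OF D Q]
  have E: "?E n \<in> sets lebesgue" for n
  proof -
    have "{x \<in> space lebesgue. \<mu>' x \<le> real n} \<in> sets lebesgue" by measurable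
    then show ?thesis using Qs by simp
  qed
  have sup: "(SUP n. ennreal (\<mu>' x) * indicator (?E n) x) = ennreal (\<mu>' x) * indicator Q x" for x
  proof (rule antisym)
    show "(SUP n. ennreal (\<mu>' x) * indicator (?E n) x) \<le> ennreal (\<mu>' x) * indicator Q x"
      by (rule SUP_least) (auto simp: indicator_def)
    obtain n where "\<mu>' x \<le> real n" using real_arch_simple by blast
    then show "ennreal (\<mu>' x) * indicator Q x \<le> (SUP n. ennreal (\<mu>' x) * indicator (?E n) x)"
      by (intro SUP_upper2[of n]) (auto simp: indicator_def)
  qed
  have "mass \<mu>' Q = (\<integral>\<^sup>+x. (SUP n. ennreal (\<mu>' x) * indicator (?E n) x) \<partial>lebesgue)"
    by (simp only: sup mass_def)
  also have "\<dots> = (SUP n. mass \<mu>' (?E n))"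
    unfolding mass_def
    by (intro nn_integral_monotone_convergence_SUP borel_measurable_times_ennreal borel_measurable_indicator E)
       (auto simp: incseq_def le_fun_def indicator_def intro: order_trans)
  also have "\<dots> \<le> ennreal (?T powr p')"
    by (rule SUP_least) (rule mass_truncated_dual_weight)
  finally have le: "mass \<mu>' Q \<le> ennreal (?T powr p')" .
  then obtain u where u: "0 \<le> u" "mass \<mu>' Q = ennreal u" by (cases "mass \<mu>' Q") (auto simp: top_unique)
  then have "u \<le> ?T powr p'" using le by simp
  then have "u powr (1 / p') \<le> (?T powr p') powr (1 / p')"
    using u(1) p' by (intro powr_mono2) auto
  then have "u powr (1 / p') \<le> ?T" using p' T by (simp add: powr_powr)
  then have "u powr (1 / p') * l powr (1 / q) \<le> K * m" using l(1) by (simp add: field_simps)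
  then show ?thesis using that u by blast
qed

end

section \<open>Collecting the estimates uniformly over all cubes\<close>

theorem lemma3p8:
  fixes D :: "int \<Rightarrow> (real^'n) set set"
    and p q p' q' r \<alpha> C :: real
    and \<mu> lam \<nu> \<mu>' :: "real^'n \<Rightarrow> real"
  assumes "dyadic_lattice D"
    and "1 < p" and "1 < q"
    and "1 / p + 1 / p' = 1" and "1 / q + 1 / q' = 1"
    and "p > q \<Longrightarrow> 1 / r = 1 / q - 1 / p"
    and "\<alpha> / real CARD('n) = 1 / p - 1 / q"
    and "weight \<mu>" and "weight lam" and "weight \<nu>"
    and "\<And>x. \<mu>' x = \<mu> x powr (- (p' / p))"
    and "C > 0"
    and "\<And>b. locally_integrable b \<Longrightarrow> paraproduct_well_defined D b \<Longrightarrow>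
           op_norm (paraproduct D b) p \<mu> q lam
             \<le> ennreal C * (if p \<le> q then BMO_norm D \<alpha> \<nu> b
                            else eLp_norm r \<nu> (sharp_maximal D \<nu> b))"
  shows "(SUP Q\<in>cubes D. epowr (eavg Q \<mu>') (1 / p') * epowr (eavg Q lam) (1 / q)
            * epowr (eavg Q \<nu>) (1 / p + 1 / q')) < \<infinity>"
proof -
  note D = assms(1)
  define s where "s = 1 / p + 1 / q'"
  \<comment> \<open>The constant in the norm bound for \<open>b\<close>: 1 for the BMO norm, and the
    root of the telescoping constant for the sharp maximal function.\<close>
  define \<kappa> where "\<kappa> = (if p \<le> q then 1 else (r / (r - 1)) powr (1 / r))"
  have s: "0 < s" "1 + \<alpha> / real CARD('n) = s"
  proof -
    have "1 / q < 1" using assms(3) by simp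
    then have "0 < 1 / p" "0 < 1 / q'" using assms(2,5) by (simp, linarith)
    then show "0 < s" by (simp only: s_def add_pos_pos)
    show "1 + \<alpha> / real CARD('n) = s" using assms(5,7) by (simp only: s_def)
  qed
  \<comment> \<open>Both cases thus lead to the same power \<open>- s\<close> of the \<nu>-mass of
    \<open>Q\<close>.\<close>
  have r: "1 < r" "1 - 1 / r = s" if "q < p"
  proof -
    have e: "1 / r = 1 / q - 1 / p" using assms(6) that by simp
    have "1 / p < 1 / q" "1 / q < 1" "0 < 1 / p" using that assms(2,3) by (auto intro: frac_less2)
    then have r: "0 < 1 / r" "1 / r < 1" using e by linarith+
    then show "1 < r" by (simp add: field_simps)
    show "1 - 1 / r = s" using e assms(5) by (simp only: s_def)
  qed
  have \<kappa>: "0 \<le> \<kappa>" by (simp add: \<kappa>_def)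
  have "epowr (eavg Q \<mu>') (1 / p') * epowr (eavg Q lam) (1 / q) * epowr (eavg Q \<nu>) (1 / p + 1 / q')
      \<le> ennreal (C * \<kappa>)" if Q: "Q \<in> cubes D" for Q
  proof -
    obtain b where b: "balanced_sign D Q b" using balanced_sign_exists[OF D Q] .
    have mass: "\<exists>v>0. mass w Q = ennreal v" if w: "weight w" for w
    proof -
      have "0 < mass w Q" "mass w Q < \<infinity>"
        using mass_weight_pos[OF w cubes_measure(2,4)[OF D Q]]
          mass_weight_bounded[OF w cubes_measure(3)[OF D Q]] .
      then show ?thesis by (cases "mass w Q") auto
    qed
    obtain v where v: "0 < v" "mass \<nu> Q = ennreal v" using mass[OF assms(10)] by blast
    obtain l where l: "0 < l" "mass lam Q = ennreal l" using mass[OF assms(9)] by blast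
    define m where "m = measure lebesgue Q"
    have m: "0 < m" using cubes_measure(4)[OF D Q] by (simp add: m_def)
    define N where "N = \<kappa> * (m * v powr (- s))"
    have N: "0 \<le> N" using \<kappa> m by (simp add: N_def)
    have "(if p \<le> q then BMO_norm D \<alpha> \<nu> b else eLp_norm r \<nu> (sharp_maximal D \<nu> b)) \<le> ennreal N"
    proof (cases "p \<le> q")
      case True
      then show ?thesis
        using BMO_norm_balanced_sign[OF D Q b assms(10) v s(2,1)] by (simp add: N_def \<kappa>_def m_def)
    next
      case False
      then have "q < p" by simp
      then show ?thesis
        using sharp_maximal_balanced_sign[OF D Q b assms(10) v r(1)] False r(2)
        by (simp add: N_def \<kappa>_def m_def)
    qed
    then have "op_norm (paraproduct D b) p \<mu> q lam \<le> ennreal C * ennreal N"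
      using assms(13)[OF balanced_sign_locally_integrable[OF D Q b]
          paraproduct_well_defined_balanced_sign[OF D Q b]]
      by (meson mult_left_mono order_trans zero_le)
    then have op: "op_norm (paraproduct D b) p \<mu> q lam \<le> ennreal (C * N)"
      using assms(12) N by (simp add: ennreal_mult)
    have "0 < q" "0 \<le> C * N" using assms(3,12) N by auto
    then obtain u where u: "0 \<le> u" "mass \<mu>' Q = ennreal u"
        "u powr (1 / p') * l powr (1 / q) \<le> C * N * m"
      using dual_weight_mass_le[OF D Q b assms(2,4) _ assms(8) weight_measurable[OF assms(9)]
          assms(11) l m_def _ op] by blast
    have avg: "eavg Q w = ennreal (t / m)" if "mass w Q = ennreal t" "0 \<le> t" for w t
      using that m emeasure_eq_measure2[OF cubes_measure(1)[OF D Q]]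
      by (simp add: eavg_def divide_ennreal flip: m_def)
    have "epowr (eavg Q \<mu>') (1 / p') * epowr (eavg Q lam) (1 / q) * epowr (eavg Q \<nu>) (1 / p + 1 / q')
      = ennreal ((u / m) powr (1 / p') * (l / m) powr (1 / q) * (v / m) powr s)"
      using avg[OF u(2,1)] avg[OF l(2)] avg[OF v(2)] u(1) l(1) v(1) m
      by (simp add: s_def flip: ennreal_mult)
    also have "(u / m) powr (1 / p') * (l / m) powr (1 / q) * (v / m) powr s
      = (u powr (1 / p') * l powr (1 / q)) * v powr s / (m powr (1 / p') * m powr (1 / q) * m powr s)"
      using u(1) l(1) v(1) m by (simp add: powr_divide)
    \<comment> \<open>The exponents add up to 2 by conjugacy. One factor \<open>m\<close> cancels
      against \<open>N\<close>, the other against the \<open>m\<close> in the bound for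
      \<open>u\<close>, leaving a constant independent of \<open>Q\<close>.\<close>
    also have "m powr (1 / p') * m powr (1 / q) * m powr s = m * m"
    proof -
      have "1 / p' + 1 / q + s = 2" using assms(4,5) by (simp add: s_def)
      then show ?thesis using m by (simp add: power2_eq_square flip: powr_add)
    qed
    also have "(u powr (1 / p') * l powr (1 / q)) * v powr s / (m * m)
        \<le> (C * N * m) * v powr s / (m * m)"
      using u(3) m by (intro divide_right_mono mult_right_mono) auto
    also have "\<dots> = C * \<kappa>"
      using m v(1) by (simp add: N_def powr_minus field_simps)
    finally show ?thesis by (simp add: ennreal_leI)
  qed
  then have "(SUP Q\<in>cubes D. epowr (eavg Q \<mu>') (1 / p') * epowr (eavg Q lam) (1 / q)
      * epowr (eavg Q \<nu>) (1 / p + 1 / q')) \<le> ennreal (C * \<kappa>)"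
    by (rule SUP_least)
  then show ?thesis by (rule le_less_trans) simp
qed

end
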